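(* Let $F:U\to\mathbb{R}^N$ be a continuous map on an open set $U\subset\mathbb{R}^N$, let $n>1$, and let $p_0\in U$ be an $n$-periodic point of $F$ (least period $n$). Suppose that the orbit $O=\{p_0,\ p_1=F(p_0),\ \dots,\ p_{n-1}=F^{n-1}(p_0)\}$ is enclosed in a contracting grid $G=h(\mathcal{G})$. Then for every $m\in\mathbb{N}$ such that $n\triangleleft m$ in the Sharkovskii order, $F$ also has an $m$-periodic point (a point of least period $m$).
   Context: The Sharkovskii order $\triangleleft$ on the positive integers is the strict total order $$3\triangleleft 5\triangleleft 7\triangleleft\dots\triangleleft 2\cdot3\triangleleft 2\cdot5\triangleleft 2\cdot7\triangleleft\dots\triangleleft 2^2\cdot3\triangleleft 2^2\cdot5\triangleleft\dots\ \dots\triangleleft 2^{k+1}\triangleleft 2^k\triangleleft\dots\triangleleft 2^2\triangleleft 2\triangleleft 1 .$$ Model grid: let $\mathcal{O}=\{1,5,\dots,4n-3\}$ be a set of $n$ points on the first coordinate axis of $\mathbb{R}^N$ (the number $k$ is identified with $(k,0,\dots,0)$). The model grid enclosing $\mathcal{O}$ is the closed hyper-cuboid $\mathcal{G}=[0,4n-2]\times[-1,1]^{N-1}$, and its inner cubes are $C_k=\{x\in\mathcal{G}: k-1\le x_1\le k+1\}$ for $k\in\mathcal{O}$. Grid: for an open $U\subset\mathbb{R}^N$ and a set $P\subset U$ of $n$ points, a set $G\subset U$ containing $P$ is a grid enclosing $P$ if there is a homeomorphism $h:V\to U$, where $V$ is an open neighborhood of $\mathcal{G}$ in $\mathbb{R}^N$,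 such that $P=h(\mathcal{O})$ and $G=h(\mathcal{G})$. Contracting grid: let $F:U\to\mathbb{R}^N$ be continuous, $P$ an $n$-periodic orbit of $F$, and $G=h(\mathcal{G})\subset U$ a grid enclosing $P$; write $F_h=h^{-1}\circ F\circ h$ (defined wherever the composition makes sense; in particular on $\mathcal{O}$, which it maps to itself). $G$ is a contracting grid if $F(G)\subset\operatorname{int}G$ and $F(h(C_k))\subset\operatorname{int}h(C_{F_h(k)})$ for every $k\in\mathcal{O}$. *)

theory Defs
  imports "HOL-Analysis.Analysis"
begin

inductive sharkovskii :: "nat \<Rightarrow> nat \<Rightarrow> bool" (infix \<open>\<lhd>\<^sub>S\<close> 50) where
  "odd p \<Longrightarrow> odd q \<Longrightarrow> 1 < p \<Longrightarrow> p < q \<Longrightarrow> 2 ^ a * p \<lhd>\<^sub>S 2 ^ a * q"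
| "odd p \<Longrightarrow> odd q \<Longrightarrow> 1 < p \<Longrightarrow> 1 < q \<Longrightarrow> a < b \<Longrightarrow> 2 ^ a * p \<lhd>\<^sub>S 2 ^ b * q"
| "odd p \<Longrightarrow> 1 < p \<Longrightarrow> 2 ^ a * p \<lhd>\<^sub>S 2 ^ b"
| "b < a \<Longrightarrow> 2 ^ a \<lhd>\<^sub>S 2 ^ b"

text \<open>
  A map \<open>F : U \<rightarrow> \<real>\<^sup>N\<close> is represented by a total function of which only the values on \<open>U\<close>
  matter, so the orbit of a periodic point is required to stay in \<open>U\<close>.
\<close>

definition periodic_point :: "'a set \<Rightarrow> ('a \<Rightarrow> 'a) \<Rightarrow> nat \<Rightarrow> 'a \<Rightarrow> bool" where
  "periodic_point U F m p \<longleftrightarrow>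
     0 < m \<and> (\<forall>k<m. (F ^^ k) p \<in> U) \<and> (F ^^ m) p = p \<and>
     (\<forall>k. 0 < k \<and> k < m \<longrightarrow> (F ^^ k) p \<noteq> p)"

definition orbit_points :: "('a \<Rightarrow> 'a) \<Rightarrow> nat \<Rightarrow> 'a \<Rightarrow> 'a set" where
  "orbit_points F n p = (\<lambda>k. (F ^^ k) p) ` {..<n}"

text \<open>
  The index type of \<open>real ^ 'N\<close> carries no order; the argument \<open>e\<close> below selects the coordinate
  that plays the role of the first one. The number \<open>k\<close> is identified with \<open>axis e k\<close>.
\<close>

definition model_orbit :: "'N::finite \<Rightarrow> nat \<Rightarrow> (real ^ 'N) set" where
  "model_orbit e n = (\<lambda>i. axis e (4 * real i + 1)) ` {..<n}"

definition model_grid :: "'N::finite \<Rightarrow> nat \<Rightarrow> (real ^ 'N) set" where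
  "model_grid e n =
     {x. 0 \<le> x $ e \<and> x $ e \<le> 4 * real n - 2 \<and> (\<forall>j. j \<noteq> e \<longrightarrow> - 1 \<le> x $ j \<and> x $ j \<le> 1)}"

definition inner_cube :: "'N::finite \<Rightarrow> nat \<Rightarrow> real ^ 'N \<Rightarrow> (real ^ 'N) set" where
  "inner_cube e n k = {x \<in> model_grid e n. k $ e - 1 \<le> x $ e \<and> x $ e \<le> k $ e + 1}"

definition grid_enclosing ::
  "'N::finite \<Rightarrow> nat \<Rightarrow> (real ^ 'N) set \<Rightarrow> (real ^ 'N) set \<Rightarrow> (real ^ 'N) set \<Rightarrow>
   (real ^ 'N) set \<Rightarrow> (real ^ 'N \<Rightarrow> real ^ 'N) \<Rightarrow> bool" where
  "grid_enclosing e n U P G V h \<longleftrightarrow>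
     open V \<and> model_grid e n \<subseteq> V \<and> (\<exists>g. homeomorphism V U h g) \<and>
     P = h ` model_orbit e n \<and> G = h ` model_grid e n"

definition conjugate ::
  "(real ^ 'N) set \<Rightarrow> (real ^ 'N \<Rightarrow> real ^ 'N) \<Rightarrow> (real ^ 'N \<Rightarrow> real ^ 'N) \<Rightarrow>
   real ^ 'N \<Rightarrow> real ^ ('N::finite)" where
  "conjugate V h F = inv_into V h \<circ> F \<circ> h"

definition contracting_grid ::
  "'N::finite \<Rightarrow> nat \<Rightarrow> (real ^ 'N) set \<Rightarrow> (real ^ 'N \<Rightarrow> real ^ 'N) \<Rightarrow> (real ^ 'N) set \<Rightarrow>
   (real ^ 'N) set \<Rightarrow> (real ^ 'N) set \<Rightarrow> (real ^ 'N \<Rightarrow> real ^ 'N) \<Rightarrow> bool" where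
  "contracting_grid e n U F P G V h \<longleftrightarrow>
     grid_enclosing e n U P G V h \<and>
     F ` G \<subseteq> interior G \<and>
     (\<forall>k \<in> model_orbit e n.
        F ` h ` inner_cube e n k \<subseteq> interior (h ` inner_cube e n (conjugate V h F k)))"

end

theory Submission
  imports Defs
begin

text \<open>
  In the coordinates given by \<open>h\<close> the grid is a chain of cubes around the orbit points with gaps
  between them. The map sends the cube around \<open>k\<close> into the cube around its image \<open>f k\<close>, so it
  stretches the region strictly between two cubes \<open>a\<close> and \<open>b\<close> across every region whose
  bounding cubes lie between \<open>f a\<close> and \<open>f b\<close>. A Poincare-Miranda argument on a product of such
  regions (obtained from Kuhn's combinatorial lemma, because the number of factors is not fixed by
  a type) turns every closed loop of these covering relations into a periodic point following the
  loop. It remains to find, for a cyclic permutation of \<open>n\<close> reals and \<open>n \<lhd>\<^sub>S m\<close>, a loop of length \<open>m\<close>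
  that forces the least period; this follows the direct proof of Sharkovskii's theorem by Burns
  and Hasselblatt. Take adjacent orbit points that are mapped across each other, and call a point
  switching if its image lies on the other side of the centre between them. If some point is not
  switching, a shortest outward spiral that leads to such a point yields the loops. If all points
  switch, the square of the permutation on the left half is treated by induction.
\<close>

section \<open>Loops of covering relations\<close>

text \<open>For nonempty \<open>P\<close> this says that \<open>f\<close> permutes \<open>P\<close>
  in a single cycle. Minimality among invariant sets needs no enumeration of the cycle and passes
  easily to \<open>f \<circ> f\<close> on a half.\<close>

definition transitive_on :: "real set \<Rightarrow> (real \<Rightarrow> real) \<Rightarrow> bool" where
  "transitive_on P f \<longleftrightarrow> finite P \<and> f ` P \<subseteq> P \<and>
     (\<forall>Q. Q \<subseteq> P \<and> Q \<noteq> {} \<and> f ` Q \<subseteq> Q \<longrightarrow> Q = P)"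

text \<open>
  A pair of reals stands for the interval spanned by its two components, in either order. A loop
  of length \<open>m\<close> is an \<open>m\<close>-periodic sequence of such intervals.
\<close>

definition covers :: "(real \<Rightarrow> real) \<Rightarrow> real \<times> real \<Rightarrow> real \<times> real \<Rightarrow> bool" where
  "covers f I J \<longleftrightarrow>
     (\<forall>x\<in>{fst J, snd J}. min (f (fst I)) (f (snd I)) \<le> x \<and> x \<le> max (f (fst I)) (f (snd I)))"

text \<open>Common endpoints are allowed: the blocks used later stay one unit away from the
  endpoints, so separated intervals still have disjoint blocks.\<close>

definition separated :: "real \<times> real \<Rightarrow> real \<times> real \<Rightarrow> bool" where
  "separated I J \<longleftrightarrow>
     max (fst I) (snd I) \<le> min (fst J) (snd J) \<or> max (fst J) (snd J) \<le> min (fst I) (snd I)"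

text \<open>The last clause excludes shorter periods: a point that follows the loop and returns
  after \<open>d\<close> steps would have an iterate in two disjoint blocks.\<close>

definition elementary_loop ::
  "real set \<Rightarrow> (real \<Rightarrow> real) \<Rightarrow> nat \<Rightarrow> (nat \<Rightarrow> real \<times> real) \<Rightarrow> bool" where
  "elementary_loop P f m J \<longleftrightarrow>
     (\<forall>i. fst (J i) \<in> P \<and> snd (J i) \<in> P \<and> fst (J i) \<noteq> snd (J i)) \<and>
     (\<forall>i. covers f (J i) (J (Suc i))) \<and> (\<forall>i. J (i + m) = J i) \<and>
     (\<forall>d. 0 < d \<and> d < m \<longrightarrow> (\<exists>i. separated (J i) (J (i + d))))"

text \<open>One interval visited once per turn and separated from all others suffices: a shift by
  \<open>d\<close> moves position \<open>m - 1\<close> to \<open>d - 1\<close> modulo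
  \<open>m\<close>.\<close>

lemma elementary_loopI:
  assumes "0 < m"
    and pts: "\<And>i. i < m \<Longrightarrow> fst (A i) \<in> P \<and> snd (A i) \<in> P \<and> fst (A i) \<noteq> snd (A i)"
    and step: "\<And>i. Suc i < m \<Longrightarrow> covers f (A i) (A (Suc i))"
    and close: "covers f (A (m - 1)) (A 0)"
    and sep: "\<And>i. Suc i < m \<Longrightarrow> separated (A (m - 1)) (A i)"
  shows "elementary_loop P f m (\<lambda>i. A (i mod m))"
  unfolding elementary_loop_def
proof (intro conjI allI impI)
  fix i
  have "i mod m < m" using \<open>0 < m\<close> by simp
  then show "fst (A (i mod m)) \<in> P" "snd (A (i mod m)) \<in> P" "fst (A (i mod m)) \<noteq> snd (A (i mod m))"
    using pts by auto
  show "covers f (A (i mod m)) (A (Suc i mod m))"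
  proof (cases "Suc (i mod m) = m")
    case True
    then show ?thesis using close by (metis mod_Suc diff_Suc_1)
  next
    case False
    then show ?thesis using step \<open>i mod m < m\<close> by (simp add: mod_Suc)
  qed
  show "A ((i + m) mod m) = A (i mod m)" by simp
next
  fix d assume d: "0 < d \<and> d < m"
  then have "(m - 1 + d) mod m = d - 1"
    using mod_add_self1[of m "d - 1"] \<open>0 < m\<close> by (simp add: add.commute less_imp_diff_less)
  then show "\<exists>i. separated (A (i mod m)) (A ((i + d) mod m))"
    using d sep[of "d - 1"] by (intro exI[of _ "m - 1"]) auto
qed

section \<open>Cyclic permutations, their squares and lifted loops\<close>

lemma transitive_on_image:
  assumes "transitive_on P f" "P \<noteq> {}"
  shows "f ` P = P" "inj_on f P"
proof -
  show "f ` P = P"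
    using assms unfolding transitive_on_def by (metis image_is_empty image_mono)
  then show "inj_on f P"
    using assms unfolding transitive_on_def by (simp add: eq_card_imp_inj_on)
qed

text \<open>Each interval is followed by its image under \<open>f\<close>, which it covers
  trivially. Even shifts are settled by the given loop; odd shifts compare an interval spanned by
  points of \<open>L\<close> with one spanned by images of such points, which lies weakly to its
  right.\<close>

lemma elementary_loop_lift:
  assumes loop: "elementary_loop L (f \<circ> f) k J"
    and "L \<subseteq> P" and inv: "f ` P \<subseteq> P" and inj: "inj_on f P"
    and sep: "\<And>x y. x \<in> L \<Longrightarrow> y \<in> L \<Longrightarrow> x \<le> f y"
  shows "elementary_loop P f (2 * k)
           (\<lambda>i. if even i then J (i div 2) else map_prod f f (J (i div 2)))"
    (is "elementary_loop P f _ ?J")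
  unfolding elementary_loop_def
proof (intro conjI allI impI)
  have J: "fst (J i) \<in> L" "snd (J i) \<in> L" "fst (J i) \<noteq> snd (J i)" for i
    using loop by (auto simp: elementary_loop_def)
  fix i
  show "fst (?J i) \<in> P" "snd (?J i) \<in> P"
    using J \<open>L \<subseteq> P\<close> inv by (auto simp: map_prod_def split_beta) blast+
  show "fst (?J i) \<noteq> snd (?J i)"
    using J inj \<open>L \<subseteq> P\<close> by (auto simp: map_prod_def split_beta) (metis inj_onD subsetD)
  show "covers f (?J i) (?J (Suc i))"
  proof (cases "even i")
    case True
    then show ?thesis by (auto simp: covers_def map_prod_def split_beta)
  next
    case False
    have "covers (f \<circ> f) (J (i div 2)) (J (Suc (i div 2)))"
      using loop by (auto simp: elementary_loop_def)
    with False show ?thesis by (auto simp: covers_def map_prod_def split_beta)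
  qed
  show "?J (i + 2 * k) = ?J i"
    using loop by (auto simp: elementary_loop_def add.commute[of k])
next
  fix d assume d: "0 < d \<and> d < 2 * k"
  have J: "fst (J i) \<in> L" "snd (J i) \<in> L" for i
    using loop by (auto simp: elementary_loop_def)
  show "\<exists>i. separated (?J i) (?J (i + d))"
  proof (cases "even d")
    case True
    then obtain e where e: "d = 2 * e" by blast
    with d have "0 < e \<and> e < k" by simp
    then obtain i where "separated (J i) (J (i + e))"
      using loop by (auto simp: elementary_loop_def)
    then show ?thesis
      using e by (intro exI[of _ "2 * i"]) auto
  next
    case False
    then have "separated (?J 0) (?J (0 + d))"
      using J sep by (simp add: separated_def map_prod_def split_beta)
    then show ?thesis by blast
  qed
qed

text \<open>If \<open>Q\<close> is invariant under the square, then \<open>Q\<close> together with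
  its image is invariant under \<open>f\<close>, hence all of \<open>P\<close>, and its part in
  \<open>L\<close> is \<open>Q\<close>.\<close>

lemma transitive_on_square:
  assumes tr: "transitive_on P f" and "P = L \<union> R" "L \<inter> R = {}" "L \<noteq> {}"
    and LR: "f ` L \<subseteq> R" and RL: "f ` R \<subseteq> L"
  shows "transitive_on L (f \<circ> f)" "card P = 2 * card L"
proof -
  have fin: "finite P" "finite L" "finite R"
    using assms by (auto simp: transitive_on_def)
  have inj: "inj_on f P"
    using transitive_on_image(2) assms by blast
  show "transitive_on L (f \<circ> f)"
    unfolding transitive_on_def
  proof (intro conjI allI impI)
    show "finite L" by fact
    show "(f \<circ> f) ` L \<subseteq> L" using LR RL by auto
    fix Q assume Q: "Q \<subseteq> L \<and> Q \<noteq> {} \<and> (f \<circ> f) ` Q \<subseteq> Q"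
    have "Q \<union> f ` Q = P"
    proof -
      have "f ` (Q \<union> f ` Q) \<subseteq> Q \<union> f ` Q" using Q by auto
      moreover have "Q \<union> f ` Q \<subseteq> P" using Q LR \<open>P = L \<union> R\<close> by auto
      ultimately show ?thesis using tr Q unfolding transitive_on_def by blast
    qed
    moreover have "f ` Q \<subseteq> R" using Q LR by blast
    ultimately show "Q = L" using Q \<open>P = L \<union> R\<close> \<open>L \<inter> R = {}\<close> by blast
  qed
  have "card L \<le> card R" "card R \<le> card L"
    using LR RL fin inj \<open>P = L \<union> R\<close> card_inj_on_le[of f L R] card_inj_on_le[of f R L]
    by (auto simp: inj_on_Un)
  then show "card P = 2 * card L"
    using fin assms by (simp add: card_Un_disjoint)
qed

text \<open>\<open>p\<close> is the largest point that moves right and \<open>q\<close> its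
  successor in \<open>P\<close>, which therefore moves left.\<close>

lemma exists_switching_pair:
  assumes tr: "transitive_on P f" and card: "1 < card P"
  obtains p q where "p \<in> P" "q \<in> P" "p < q" "\<And>x. x \<in> P \<Longrightarrow> x \<le> p \<or> q \<le> x" "q \<le> f p" "f q \<le> p"
proof -
  have fin: "finite P" and ne: "P \<noteq> {}" and inv: "\<And>x. x \<in> P \<Longrightarrow> f x \<in> P"
    using assms by (auto simp: transitive_on_def)
  have nofix: "f x \<noteq> x" if "x \<in> P" for x
  proof
    assume "f x = x"
    then have "{x} = P" using tr that unfolding transitive_on_def by blast
    then show False using card by force
  qed
  define A where "A = {x \<in> P. x < f x}"
  have "Min P \<in> A"
    using fin ne inv[OF Min_in] nofix[OF Min_in] by (simp add: A_def order_less_le)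
  then have A: "finite A" "A \<noteq> {}" using fin by (auto simp: A_def)
  define p where "p = Max A"
  have p: "p \<in> P" "p < f p" using Max_in[OF A] by (auto simp: p_def A_def)
  define B where "B = {x \<in> P. p < x}"
  have B: "finite B" "B \<noteq> {}" using fin p inv by (auto simp: B_def)
  define q where "q = Min B"
  have q: "q \<in> P" "p < q" using Min_in[OF B] by (auto simp: q_def B_def)
  have adj: "x \<le> p \<or> q \<le> x" if "x \<in> P" for x
    using Min_le[OF B(1), of x] that by (force simp: q_def B_def)
  have "q \<notin> A" using q A by (auto simp: p_def not_le[symmetric])
  then have "f q < q" using nofix q by (force simp: A_def)
  then show ?thesis using that[OF p(1) q adj] p q inv adj by force
qed

text \<open>A shortest outward spiral from \<open>p\<close> to a nonswitching point visits
  \<open>N + 1 \<le> card P\<close> distinct points. Its straddling intervals and one outer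
  interval, visited once per turn, form loops of every length above \<open>N\<close> and of every
  positive even length.\<close>

lemma nonswitching_loop:
  assumes tr: "transitive_on P f"
    and pq: "p \<in> P" "q \<in> P" "p < q" "\<And>x. x \<in> P \<Longrightarrow> x \<le> p \<or> q \<le> x" "q \<le> f p" "f q \<le> p"
    and w: "w \<in> P" "(w \<le> p) = (f w \<le> p)"
    and m: "even m \<and> 0 < m \<or> card P \<le> m"
  shows "\<exists>J. elementary_loop P f m J"
proof -
  have fin: "finite P" and inv: "\<And>x. x \<in> P \<Longrightarrow> f x \<in> P"
    using tr by (auto simp: transitive_on_def)
  \<comment> \<open>\<open>D\<close> is twice the distance to the midpoint of \<open>p\<close> and
    \<open>q\<close>. A path changes sides at each step, each next point lies at most as far out as
    the image of the previous one, and only the last point is nonswitching.\<close>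
  define D where "D x = \<bar>2 * x - p - q\<bar>" for x
  define sw where "sw x \<longleftrightarrow> (x \<le> p) \<noteq> (f x \<le> p)" for x
  define path where "path N y \<longleftrightarrow> y 0 = p \<and> (\<forall>j\<le>N. y j \<in> P) \<and> \<not> sw (y N) \<and>
      (\<forall>j<N. sw (y j) \<and> (y j \<le> p) \<noteq> (y (Suc j) \<le> p) \<and> D (y (Suc j)) \<le> D (f (y j)))"
    for N and y :: "nat \<Rightarrow> real"
  \<comment> \<open>The orbit of \<open>p\<close> fills \<open>P\<close>, hence meets
    \<open>w\<close>; stopped at its first nonswitching point it is a path.\<close>
  have "\<exists>N y. path N y"
  proof -
    have it: "(f ^^ j) p \<in> P" for j by (induction j) (auto simp: pq inv)
    have "\<exists>j. \<not> sw ((f ^^ j) p)"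
    proof -
      have "range (\<lambda>j. (f ^^ j) p) = P"
      proof -
        have "range (\<lambda>j. (f ^^ j) p) \<subseteq> P" using it by auto
        moreover have "f ` range (\<lambda>j. (f ^^ j) p) \<subseteq> range (\<lambda>j. (f ^^ j) p)"
        proof safe
          fix j show "f ((f ^^ j) p) \<in> range (\<lambda>j. (f ^^ j) p)"
            using rangeI[of "\<lambda>j. (f ^^ j) p" "Suc j"] by simp
        qed
        ultimately show ?thesis using tr unfolding transitive_on_def by blast
      qed
      then obtain j where "w = (f ^^ j) p" using w by blast
      then show ?thesis using w by (auto simp: sw_def intro: exI[of _ j])
    qed
    then have "\<not> sw ((f ^^ (LEAST j. \<not> sw ((f ^^ j) p))) p)"
      by (rule LeastI_ex)
    moreover have "sw ((f ^^ j) p)" if "j < (LEAST j. \<not> sw ((f ^^ j) p))" for j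
      using not_less_Least[OF that] by simp
    ultimately have "path (LEAST j. \<not> sw ((f ^^ j) p)) (\<lambda>j. (f ^^ j) p)"
      unfolding path_def using it by (simp, simp add: sw_def)
    then show ?thesis by blast
  qed
  define N where "N = (LEAST N. \<exists>y. path N y)"
  obtain y where y: "path N y"
    using LeastI_ex[OF \<open>\<exists>N y. path N y\<close>] unfolding N_def by blast
  have min: "N \<le> N'" if "path N' z" for N' z
    unfolding N_def using that by (auto intro: Least_le)
  have yP: "y j \<in> P" if "j \<le> N" for j using y that by (auto simp: path_def)
  have y0: "y 0 = p" and yN: "\<not> sw (y N)" using y by (auto simp: path_def)
  have ysw: "sw (y j)" and yD: "D (y (Suc j)) \<le> D (f (y j))" if "j < N" for j
    using y that by (auto simp: path_def)
  have side: "(y j \<le> p) = even j" if "j \<le> N" for j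
    using that
  proof (induction j)
    case (Suc j)
    then have "(y j \<le> p) \<noteq> (y (Suc j) \<le> p)" using y by (auto simp: path_def)
    then show ?case using Suc by auto
  qed (simp add: y0)
  have near: "D p \<le> D x" "D q \<le> D x" if "x \<in> P" for x
    using pq(3) pq(4)[OF that] by (auto simp: D_def)
  have Deq: "x = x'" if "x \<in> P" "x' \<in> P" "(x \<le> p) = (x' \<le> p)" "D x = D x'" for x x'
    using that pq(3) pq(4)[of x] pq(4)[of x'] by (auto simp: D_def abs_if split: if_splits)
  text \<open>Otherwise the part of the path between the two points could be cut out.\<close>
  have far: "D (y j) < D (y (j + 2))" if "j + 2 \<le> N" for j
  proof (rule ccontr)
    assume "\<not> ?thesis"
    then have le: "D (y (j + 2)) \<le> D (y j)" by simp
    define z where "z i = (if i < j then y i else y (i + 2))" for i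
    have "path (N - 2) z"
      unfolding path_def
    proof (intro conjI allI impI)
      show "z 0 = p"
      proof (cases "j = 0")
        \<comment> \<open>Cutting at the start keeps the initial point: \<open>y 2\<close> is on the
          side of \<open>p\<close> and no farther out, and \<open>p\<close> is innermost
          there.\<close>
        case True
        have "2 \<le> N" using that by simp
        then have "y 2 \<in> P" "y 2 \<le> p"
          using yP[of 2] side[of 2] by simp_all
        moreover have "D (y 2) \<le> D p"
          using le unfolding True by (simp only: y0 add_0)
        ultimately have "y 2 = p"
          using near(1)[of "y 2"] pq(1) by (simp add: Deq)
        then show ?thesis unfolding z_def True by (simp only: less_nat_zero_code if_False add_0)
      qed (simp add: z_def y0)
      show "z i \<in> P" if "i \<le> N - 2" for i
        using that \<open>j + 2 \<le> N\<close> yP by (auto simp: z_def)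
      have "\<not> N - 2 < j" "N - 2 + 2 = N" using that by simp_all
      then show "\<not> sw (z (N - 2))"
        unfolding z_def using yN by (simp only: if_False not_False_eq_True)
      fix i assume i: "i < N - 2"
      show "sw (z i)" using i ysw by (auto simp: z_def)
      show "(z i \<le> p) \<noteq> (z (Suc i) \<le> p)"
        using i that by (auto simp: z_def side)
      show "D (z (Suc i)) \<le> D (f (z i))"
      proof (cases "Suc i = j")
        case True
        then have "D (y (j + 2)) \<le> D (f (y i))" using le yD[of i] that by simp
        then show ?thesis using True by (simp add: z_def)
      next
        case False
        then show ?thesis using i yD[of i] yD[of "i + 2"] by (auto simp: z_def)
      qed
    qed
    then show False using min[of "N - 2" z] that by simp
  qed
  have mono: "D (y i) \<le> D (y (i + 2 * k))" if "i + 2 * k \<le> N" for i k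
    using that
  proof (induction k)
    case (Suc k)
    then show ?case using far[of "i + 2 * k"] by simp
  qed simp
  have mono': "D (y i) \<le> D (y j)" if "i \<le> j" "j \<le> N" "even i = even j" for i j
  proof -
    from that have "even (j - i)" by auto
    then obtain k where "j - i = 2 * k" by blast
    then have "j = i + 2 * k" using that by simp
    then show ?thesis using mono[of i k] that by simp
  qed
  have strict: "D (y i) < D (y j)" if "i < j" "j \<le> N" "even i = even j" for i j
  proof -
    have "i + 2 \<le> j" using that by (metis Suc_leI add_2_eq_Suc' even_Suc le_antisym not_less_eq_eq)
    then show ?thesis using far[of i] mono'[of "i + 2" j] that by simp
  qed
  have "inj_on y {..N}"
  proof (rule linorder_inj_onI')
    fix i j assume ij: "i \<in> {..N}" "j \<in> {..N}" "i < j"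
    then show "y i \<noteq> y j" using side[of i] side[of j] strict[of i j] by auto
  qed
  then have "card {..N} \<le> card P"
    using fin yP by (intro card_inj_on_le) auto
  then have NP: "Suc N \<le> card P" by simp
  have swp: "sw p" "sw q" using pq by (auto simp: sw_def)
  have N0: "0 < N" using yN y0 swp by (cases N) auto
  text \<open>A segment joining two points on different sides contains every point that lies at most as
    far out as the endpoint on its own side.\<close>
  have hull: "covers f I J"
    if "(f (fst I) \<le> p) \<noteq> (f (snd I) \<le> p)" "fst I \<in> P" "snd I \<in> P" "fst J \<in> P" "snd J \<in> P"
       "\<And>x. x \<in> {fst J, snd J} \<Longrightarrow>
          (if (x \<le> p) = (f (fst I) \<le> p) then D x \<le> D (f (fst I)) else D x \<le> D (f (snd I)))"
    for I J
  proof -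
    have "x \<in> P \<Longrightarrow> min (f (fst I)) (f (snd I)) \<le> x \<and> x \<le> max (f (fst I)) (f (snd I))"
      if "x \<in> {fst J, snd J}" for x
      using \<open>(f (fst I) \<le> p) \<noteq> (f (snd I) \<le> p)\<close> pq(3) pq(4)[of x]
        pq(4)[OF inv, OF \<open>fst I \<in> P\<close>] pq(4)[OF inv, OF \<open>snd I \<in> P\<close>]
        \<open>\<And>x. x \<in> {fst J, snd J} \<Longrightarrow> _\<close>[OF that]
      by (auto simp: D_def abs_if min_def max_def split: if_splits)
    then show ?thesis using that by (auto simp: covers_def)
  qed
  text \<open>\<open>c j\<close> is the innermost point on the side opposite to \<open>y j\<close>. The intervals \<open>B j\<close> straddle the
    centre, and \<open>(v, y N)\<close> overlaps none of them: a loop that visits it exactly once is not a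
    repetition of a shorter one.\<close>
  define c where "c j = (if even j then q else p)" for j :: nat
  define B where "B j = (c j, y j)" for j
  \<comment> \<open>\<open>v\<close> is the preceding point on the side of \<open>y N\<close>; for
    \<open>N = 1\<close> there is none, and \<open>q\<close> takes its place.\<close>
  define v where "v = (if N = 1 then q else y (N - 2))"
  have cP: "c j \<in> P" "(c j \<le> p) = odd j" "sw (c j)" "\<And>x. x \<in> P \<Longrightarrow> D (c j) \<le> D x" for j
    using pq swp near by (auto simp: c_def)
  have v: "v \<in> P" "(v \<le> p) = even N" "sw v"
    using N0 pq swp yP side[of "N - 2"] ysw by (auto simp: v_def)
  have vN: "D v < D (y N)"
  proof (cases "N = 1")
    case True
    have "q \<noteq> y N" using swp yN by auto
    then show ?thesis using True near(2)[OF yP] Deq[of q "y N"] pq yP side[of N]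
      by (force simp: v_def)
  next
    case False
    then have "N - 2 + 2 = N" using N0 by simp
    then have "D (y (N - 2)) < D (y N)" using far[of "N - 2"] by (simp only: order_refl)
    then show ?thesis using False by (simp add: v_def)
  qed
  have v_far: "D (y j) \<le> D v" if "j < N" "even j = even N" for j
  proof -
    have "2 \<le> N" "j \<le> N - 2" using that by presburger+
    then show ?thesis using mono'[of j "N - 2"] that by (auto simp: v_def)
  qed
  \<comment> \<open>\<open>f v\<close> lies on the side of \<open>y (N - 1)\<close> and at least as
    far out, by the path step from \<open>y (N - 2)\<close>; for \<open>N = 1\<close> the point
    \<open>y 0 = p\<close> is innermost.\<close>
  have fv_far: "D (y j) \<le> D (f v)" if "j < N" "odd j = even N" for j
  proof (cases "N = 1")
    case True
    then show ?thesis using that near inv v y0 by simp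
  next
    case False
    then have "D (y j) \<le> D (y (N - 1))" using that N0 by (intro mono') auto
    moreover have "Suc (N - 2) = N - 1" using False N0 by simp
    ultimately show ?thesis using False N0 yD[of "N - 2"] by (simp add: v_def)
  qed
  have B: "fst (B j) \<in> P" "snd (B j) \<in> P" "fst (B j) \<noteq> snd (B j)" if "j < N" for j
    using that cP(1,2)[of j] yP[of j] side[of j] by (auto simp: B_def)
  have BB: "covers f (B j) (B (Suc j))" if "Suc j < N" for j
  proof (rule hull)
    have "sw (y j)" "sw (c j)" using that ysw cP by auto
    then show "(f (fst (B j)) \<le> p) \<noteq> (f (snd (B j)) \<le> p)"
      using that side[of j] cP by (auto simp: B_def sw_def)
    fix x assume "x \<in> {fst (B (Suc j)), snd (B (Suc j))}"
    then consider "x = c (Suc j)" | "x = y (Suc j)" by (auto simp: B_def)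
    then show "if (x \<le> p) = (f (fst (B j)) \<le> p) then D x \<le> D (f (fst (B j)))
        else D x \<le> D (f (snd (B j)))"
    proof cases
      case 1
      then show ?thesis using that cP yP inv by (simp add: B_def)
    next
      case 2
      have "f (c j) \<le> p \<longleftrightarrow> even j" using cP[of j] by (auto simp: sw_def)
      then show ?thesis using 2 that side[of "Suc j"] yD[of j] by (simp add: B_def)
    qed
  qed (use that yP cP in \<open>auto simp: B_def\<close>)
  \<comment> \<open>\<open>B 0\<close> is spanned by \<open>p\<close> and \<open>q\<close>, the
    innermost points on the two sides.\<close>
  have B0: "covers f I (B 0)" if "(f (fst I) \<le> p) \<noteq> (f (snd I) \<le> p)" "fst I \<in> P" "snd I \<in> P" for I
    using that pq near inv by (intro hull) (auto simp: B_def c_def y0)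
  have BK: "covers f (B (N - 1)) (v, y N)"
  proof (rule hull)
    have "sw (y (N - 1))" "sw (c (N - 1))" using N0 ysw cP by auto
    then show "(f (fst (B (N - 1))) \<le> p) \<noteq> (f (snd (B (N - 1))) \<le> p)"
      using side[of "N - 1"] cP by (auto simp: B_def sw_def)
    have "f (c (N - 1)) \<le> p \<longleftrightarrow> odd N" using cP[of "N - 1"] N0 by (auto simp: sw_def)
    moreover have "D (y N) \<le> D (f (y (N - 1)))" using yD[of "N - 1"] N0 by simp
    moreover fix x assume "x \<in> {fst (v, y N), snd (v, y N)}"
    ultimately show "if (x \<le> p) = (f (fst (B (N - 1))) \<le> p) then D x \<le> D (f (fst (B (N - 1))))
        else D x \<le> D (f (snd (B (N - 1))))"
      using vN v side[of N] by (auto simp: B_def)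
  qed (use yP cP v in \<open>auto simp: B_def\<close>)
  have fK: "(f v \<le> p) = odd N" "(f (y N) \<le> p) = even N"
    using v yN side[of N] by (auto simp: sw_def)
  \<comment> \<open>\<open>v\<close> switches and \<open>y N\<close> does not, so their images lie
    on different sides. The parity condition puts \<open>y j\<close> on the side of
    \<open>f v\<close>, which is far enough out, and the innermost point \<open>c j\<close> on the
    side of \<open>f (y N)\<close>.\<close>
  have KB: "covers f (v, y N) (B j)" if "j < N" "odd j = even N" for j
  proof (rule hull)
    fix x assume "x \<in> {fst (B j), snd (B j)}"
    then show "if (x \<le> p) = (f (fst (v, y N)) \<le> p) then D x \<le> D (f (fst (v, y N)))
        else D x \<le> D (f (snd (v, y N)))"
      using fK fv_far[OF that] that cP side[of j] yP inv by (auto simp: B_def)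
  qed (use that fK yP cP v in \<open>auto simp: B_def\<close>)
  have KB0: "covers f (v, y N) (B 0)"
    using fK v yP by (intro B0) auto
  have BB0: "covers f (B 0) (B 0)"
    using pq by (intro B0) (auto simp: B_def c_def y0)
  \<comment> \<open>On the side of \<open>v\<close> the endpoint of \<open>B j\<close> is
    \<open>y j\<close> if \<open>j\<close> has the parity of \<open>N\<close>, and the innermost
    point \<open>c j\<close> otherwise; neither lies beyond \<open>v\<close>.\<close>
  have sep: "separated (v, y N) (B j)" if "j < N" for j
  proof -
    have *: "(x \<le> p) \<noteq> even N \<or> D x \<le> D v" if "x \<in> {c j, y j}" for x
      using that \<open>j < N\<close> v_far[of j] side[of j] cP v by auto
    have "y N \<in> P" "c j \<in> P" "y j \<in> P" using that yP cP by auto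
    then show ?thesis
      using *[of "c j"] *[of "y j"] vN v side[of N] pq(3) pq(4)[of "c j"] pq(4)[of "y j"] pq(4)[of v] pq(4)[of "y N"]
      by (cases "even N") (auto simp: separated_def B_def D_def abs_if split: if_splits)
  qed
  have m0: "0 < m" using m NP by auto
  text \<open>By truncated subtraction the loop starts with \<open>m - N\<close> copies of \<open>B 0\<close> if \<open>m > N\<close>; otherwise it
    starts at \<open>B (N + 1 - m)\<close>, which \<open>(v, y N)\<close> covers for even \<open>m\<close>.\<close>
  define A where "A i = (if i = m - 1 then (v, y N) else B (i + (N + 1) - m))" for i
  show ?thesis
  proof (cases "m = 1")
    case True
    have "elementary_loop P f 1 (\<lambda>i. (\<lambda>_. B 0) (i mod 1))"
      using BB0 pq by (intro elementary_loopI) (auto simp: B_def c_def y0)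
    then show ?thesis using True by auto
  next
    case False
    have idx: "i + (N + 1) - m < N" if "i \<noteq> m - 1" "i < m" for i
      using that N0 by linarith
    have "elementary_loop P f m (\<lambda>i. A (i mod m))"
    proof (rule elementary_loopI)
      fix i assume "i < m"
      then show "fst (A i) \<in> P \<and> snd (A i) \<in> P \<and> fst (A i) \<noteq> snd (A i)"
        using idx[of i] B v vN yP[of N] by (auto simp: A_def)
    next
      fix i assume i: "Suc i < m"
      then show "separated (A (m - 1)) (A i)"
        using idx[of i] sep by (auto simp: A_def)
      show "covers f (A i) (A (Suc i))"
      proof (cases "Suc i = m - 1")
        case True
        then have "i + (N + 1) - m = N - 1" using i by linarith
        then show ?thesis using True BK by (simp add: A_def)
      next
        case False
        then have "Suc i + (N + 1) - m < N" using i idx[of "Suc i"] by simp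
        moreover have "i + (N + 1) - m = 0 \<and> Suc i + (N + 1) - m = 0 \<or>
          Suc i + (N + 1) - m = Suc (i + (N + 1) - m)" by linarith
        ultimately show ?thesis using False i BB BB0 by (auto simp: A_def)
      qed
    next
      have A0: "A 0 = B (N + 1 - m)" using False m0 by (simp add: A_def)
      have "N + 1 - m = 0 \<or> N + 1 - m < N \<and> odd (N + 1 - m) = even N"
        using m NP m0 by auto
      then show "covers f (A (m - 1)) (A 0)"
        using KB KB0 unfolding A0 by (auto simp: A_def)
    qed (fact m0)
    then show ?thesis by blast
  qed
qed

section \<open>Loops forced by the Sharkovskii order\<close>

text \<open>An odd \<open>m > 1\<close> is preceded only by smaller odd numbers. Apart from
  \<open>m = 1\<close>, the lengths listed are those that a nonswitching point provides.\<close>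

lemma sharkovskii_one_or_even_or_greater:
  assumes "n \<lhd>\<^sub>S m"
  shows "m = 1 \<or> (even m \<and> 0 < m) \<or> n < m"
  using assms
proof cases
  case (3 p a b)
  then show ?thesis by (cases b) auto
next
  case (4 b a)
  then show ?thesis by (cases b) auto
qed auto

text \<open>Each rule survives removing a factor two on both sides, which matches passing to the
  square of the map on half of the points.\<close>

lemma sharkovskii_half:
  assumes "n \<lhd>\<^sub>S m" "even n" "m \<noteq> 1"
  obtains k where "m = 2 * k" "n div 2 \<lhd>\<^sub>S k"
  using assms(1)
proof cases
  case (1 p q a)
  with assms(2) obtain a' where "a = Suc a'" by (cases a) auto
  with 1 show ?thesis
    using that[of "2 ^ a' * q"] sharkovskii.intros(1)[of p q a'] by auto
next
  case (2 p q a b)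
  with assms(2) obtain a' b' where "a = Suc a'" "b = Suc b'" by (cases a; cases b) auto
  with 2 show ?thesis
    using that[of "2 ^ b' * q"] sharkovskii.intros(2)[of p q a' b'] by auto
next
  case (3 p a b)
  with assms obtain a' b' where "a = Suc a'" "b = Suc b'" by (cases a; cases b) auto
  with 3 show ?thesis
    using that[of "2 ^ b'"] sharkovskii.intros(3)[of p a' b'] by auto
next
  case (4 b a)
  with assms obtain a' b' where "a = Suc a'" "b = Suc b'" by (cases a; cases b) auto
  with 4 show ?thesis
    using that[of "2 ^ b'"] sharkovskii.intros(4)[of b' a'] by auto
qed

lemma not_one_sharkovskii: "\<not> 1 \<lhd>\<^sub>S m"
proof
  assume "1 \<lhd>\<^sub>S m"
  then show False by cases (auto simp: eq_commute[of "Suc 0"])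
qed

lemma sharkovskii_loop:
  assumes "transitive_on P f" "card P = n" "1 < n" "n \<lhd>\<^sub>S m"
  shows "\<exists>J. elementary_loop P f m J"
  using assms
proof (induction n arbitrary: P f m rule: less_induct)
  case (less n)
  have inv: "f ` P \<subseteq> P" and "P \<noteq> {}"
    using less.prems by (auto simp: transitive_on_def)
  obtain p q where pq: "p \<in> P" "q \<in> P" "p < q" "\<And>x. x \<in> P \<Longrightarrow> x \<le> p \<or> q \<le> x" "q \<le> f p" "f q \<le> p"
    using exists_switching_pair[of P f] less.prems by auto
  show ?case
  proof (cases "m = 1")
    case True
    have "elementary_loop P f 1 (\<lambda>i. (\<lambda>_. (p, q)) (i mod 1))"
      using pq by (intro elementary_loopI) (auto simp: covers_def)
    then show ?thesis using True by auto
  next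
    case m: False
    show ?thesis
    proof (cases "\<exists>w\<in>P. (w \<le> p) = (f w \<le> p)")
      case True
      then show ?thesis
        using nonswitching_loop[OF less.prems(1) pq, of _ m] m less.prems
          sharkovskii_one_or_even_or_greater[OF less.prems(4)] by auto
    next
      case False
      define L where "L = {x \<in> P. x \<le> p}"
      define R where "R = {x \<in> P. \<not> x \<le> p}"
      have LR: "f ` L \<subseteq> R" "f ` R \<subseteq> L"
        using False inv by (auto simp: L_def R_def)
      have "transitive_on L (f \<circ> f)" and card: "card P = 2 * card L"
        using transitive_on_square[OF less.prems(1), of L R] LR pq by (auto simp: L_def R_def)
      moreover obtain k where k: "m = 2 * k" "card L \<lhd>\<^sub>S k"
        using sharkovskii_half[OF less.prems(4) _ m] card less.prems by auto
      \<comment> \<open>A one-point left half would put \<open>1\<close> before \<open>k\<close>,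
        but \<open>1\<close> is the last element of the order.\<close>
      moreover have "1 < card L"
        using card k(2) not_one_sharkovskii[of k] less.prems
        by (cases "card L = 1") auto
      moreover have "card L < n" using card less.prems by simp
      ultimately obtain J where "elementary_loop L (f \<circ> f) k J"
        using less.IH[of "card L" L "f \<circ> f" k] by blast
      moreover have "x \<le> f y" if "x \<in> L" "y \<in> L" for x y
        using that LR by (fastforce simp: L_def R_def)
      ultimately show ?thesis
        using elementary_loop_lift[of L f k J P] inv
          transitive_on_image(2)[OF less.prems(1) \<open>P \<noteq> {}\<close>] k(1) by (auto simp: L_def)
    qed
  qed
qed

section \<open>Periodic points following a loop\<close>

text \<open>The points of a fine subdivision are labelled by the signs of the components of
  \<open>F\<close>. Kuhn's lemma yields a cell in which every component takes both weak signs, so by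
  \<open>uc\<close> all are small at its corner. Coordinates outside \<open>A\<close> stay fixed at
  \<open>a\<close>.\<close>

lemma poincare_miranda_approx:
  fixes F :: "('i \<Rightarrow> real) \<Rightarrow> 'i \<Rightarrow> real" and a b :: "'i \<Rightarrow> real"
  defines "in_box x \<equiv> (\<forall>i. a i \<le> x i \<and> x i \<le> b i)"
  assumes fin: "finite A" and ab: "\<And>i. a i \<le> b i" and "0 < \<delta>"
    and uc: "\<And>x y i. in_box x \<Longrightarrow> in_box y \<Longrightarrow> (\<And>j. j \<in> A \<Longrightarrow> \<bar>x j - y j\<bar> \<le> \<delta>) \<Longrightarrow> i \<in> A \<Longrightarrow>
      \<bar>F x i - F y i\<bar> \<le> \<epsilon>"
    and lo: "\<And>x i. in_box x \<Longrightarrow> i \<in> A \<Longrightarrow> x i = a i \<Longrightarrow> F x i \<le> 0"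
    and hi: "\<And>x i. in_box x \<Longrightarrow> i \<in> A \<Longrightarrow> x i = b i \<Longrightarrow> 0 \<le> F x i"
  obtains x where "in_box x" "\<And>i. i \<in> A \<Longrightarrow> \<bar>F x i\<bar> \<le> \<epsilon>"
proof -
  define d where "d = card A"
  obtain e where e: "bij_betw e {0..<d} A"
    unfolding d_def using ex_bij_betw_nat_finite[OF fin] by blast
  define idx where "idx = inv_into {0..<d} e"
  have idx: "idx j < d" "e (idx j) = j" if "j \<in> A" for j
    using e that bij_betw_inv_into_right[OF e that] bij_betw_apply[OF bij_betw_inv_into[OF e] that]
    by (auto simp: idx_def)
  have e_in: "e i \<in> A" "idx (e i) = i" if "i < d" for i
    using e that bij_betw_inv_into_left[OF e, of i] bij_betw_apply[OF e, of i] by (auto simp: idx_def)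
  define M where "M = (\<Sum>j\<in>A. b j - a j)"
  have M: "b j - a j \<le> M" if "j \<in> A" for j
    unfolding M_def by (rule member_le_sum) (use fin ab that in auto)
  have "0 \<le> M" unfolding M_def using ab by (simp add: sum_nonneg)
  \<comment> \<open>With more than \<open>M / \<delta>\<close> subdivisions every edge of a cell has
    length at most \<open>\<delta>\<close>.\<close>
  obtain n where n: "M / \<delta> < real n" using reals_Archimedean2 by blast
  define p where "p = Suc n"
  have p: "0 < p" "M \<le> \<delta> * p"
    using n \<open>0 < \<delta>\<close> by (auto simp: p_def field_simps)
  define X where "X q j = (if j \<in> A then a j + real (q (idx j)) / p * (b j - a j) else a j)" for q j
  have in_box: "in_box (X q)" if "\<And>i. i < d \<Longrightarrow> q i \<le> p" for q
    unfolding in_box_def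
  proof
    fix j
    show "a j \<le> X q j \<and> X q j \<le> b j"
    proof (cases "j \<in> A")
      case True
      then have "real (q (idx j)) / p \<le> 1" using that[of "idx j"] idx p by auto
      then have "real (q (idx j)) / p * (b j - a j) \<le> 1 * (b j - a j)"
        using ab[of j] by (intro mult_right_mono) auto
      then show ?thesis using True ab[of j] by (simp add: X_def)
    qed (use ab in \<open>simp add: X_def\<close>)
  qed
  have close: "\<bar>X r j - X q j\<bar> \<le> \<delta>" if "j \<in> A" and "\<And>i. i < d \<Longrightarrow> q i \<le> r i \<and> r i \<le> q i + 1" for q r j
  proof -
    have "\<bar>X r j - X q j\<bar> = \<bar>real (r (idx j)) - real (q (idx j))\<bar> / p * (b j - a j)"
      using ab[of j] that(1) p
      by (simp add: X_def abs_mult abs_divide flip: left_diff_distrib diff_divide_distrib)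
    also have "\<dots> \<le> 1 / p * M"
      using that(2)[of "idx j"] idx[OF that(1)] M[OF that(1)] ab[of j] p
      by (intro mult_mono divide_right_mono) auto
    also have "\<dots> \<le> \<delta>" using p by (simp add: field_simps)
    finally show ?thesis .
  qed
  \<comment> \<open>Kuhn's lemma prescribes the labels on the faces; \<open>lo\<close> and
    \<open>hi\<close> make them agree with the signs.\<close>
  define label :: "(nat \<Rightarrow> nat) \<Rightarrow> nat \<Rightarrow> nat" where
    "label q i = (if q i = 0 then 0 else if q i = p then 1 else if F (X q) (e i) \<le> 0 then 0 else 1)" for q i
  obtain q where q: "\<And>i. i < d \<Longrightarrow> q i < p"
    and rs: "\<forall>i<d. \<exists>r s. (\<forall>j<d. q j \<le> r j \<and> r j \<le> q j + 1) \<and> (\<forall>j<d. q j \<le> s j \<and> s j \<le> q j + 1) \<and>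
      label r i \<noteq> label s i"
  proof (rule kuhn_lemma[of p d label])
    show "\<forall>x. (\<forall>i<d. x i \<le> p) \<longrightarrow> (\<forall>i<d. label x i = 0 \<or> label x i = 1)"
      "\<forall>x. (\<forall>i<d. x i \<le> p) \<longrightarrow> (\<forall>i<d. x i = 0 \<longrightarrow> label x i = 0)"
      "\<forall>x. (\<forall>i<d. x i \<le> p) \<longrightarrow> (\<forall>i<d. x i = p \<longrightarrow> label x i = 1)"
      using p by (simp_all add: label_def)
  qed (use p in auto)
  have label0: "F (X r) (e i) \<le> 0" if "i < d" "\<And>i. i < d \<Longrightarrow> r i \<le> p" "label r i = 0" for r i
  proof (cases "r i = 0")
    case True
    then show ?thesis using that e_in by (intro lo in_box) (auto simp: X_def)
  next
    case False
    then show ?thesis using that p by (auto simp: label_def split: if_splits)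
  qed
  have label1: "0 \<le> F (X r) (e i)" if "i < d" "\<And>i. i < d \<Longrightarrow> r i \<le> p" "label r i \<noteq> 0" for r i
  proof (cases "r i = p")
    case True
    then show ?thesis using that e_in p by (intro hi in_box) (auto simp: X_def)
  next
    case False
    then show ?thesis using that by (auto simp: label_def split: if_splits)
  qed
  show ?thesis
  proof
    show "in_box (X q)" using in_box q less_imp_le by blast
    fix j assume j: "j \<in> A"
    then obtain r s where r: "\<And>i. i < d \<Longrightarrow> q i \<le> r i \<and> r i \<le> q i + 1"
      and s: "\<And>i. i < d \<Longrightarrow> q i \<le> s i \<and> s i \<le> q i + 1" and ne: "label r (idx j) \<noteq> label s (idx j)"
      using rs idx by blast
    have rp: "r i \<le> p" "s i \<le> p" if "i < d" for i
      using r[OF that] s[OF that] q[OF that] by auto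
    have "\<bar>F (X r) j - F (X q) j\<bar> \<le> \<epsilon>"
      using q rp close r j by (intro uc in_box) (auto simp: less_imp_le)
    moreover have "\<bar>F (X s) j - F (X q) j\<bar> \<le> \<epsilon>"
      using q rp close s j by (intro uc in_box) (auto simp: less_imp_le)
    moreover have "F (X r) j \<le> 0 \<and> 0 \<le> F (X s) j \<or> F (X s) j \<le> 0 \<and> 0 \<le> F (X r) j"
    proof (cases "label r (idx j) = 0")
      case True
      then show ?thesis
        using label0[of "idx j" r] label1[of "idx j" s] ne rp idx[OF j] by auto
    next
      case False
      moreover have "label s (idx j) = 0" using False ne by (auto simp: label_def split: if_splits)
      ultimately show ?thesis
        using label0[of "idx j" s] label1[of "idx j" r] rp idx[OF j] by auto
    qed
    ultimately show "\<bar>F (X q) j\<bar> \<le> \<epsilon>" by linarith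
  qed
qed

text \<open>In grid coordinates this is the slab from the cube around the smaller endpoint to the
  cube around the larger one, with the bounding faces and all cubes in between.\<close>

definition block :: "'N::finite \<Rightarrow> real \<times> real \<Rightarrow> (real ^ 'N) set" where
  "block e I = {x. min (fst I) (snd I) + 1 \<le> x $ e \<and> x $ e \<le> max (fst I) (snd I) - 1 \<and>
     (\<forall>j. j \<noteq> e \<longrightarrow> - 1 \<le> x $ j \<and> x $ j \<le> 1)}"

lemma closed_block: "closed (block e I)"
proof -
  have "block e I = {x. min (fst I) (snd I) + 1 \<le> x $ e} \<inter> {x. x $ e \<le> max (fst I) (snd I) - 1} \<inter>
    (\<Inter>j\<in>-{e}. {x. - 1 \<le> x $ j} \<inter> {x. x $ j \<le> 1})"
    by (auto simp: block_def)
  also have "closed \<dots>"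
    by (intro closed_Int closed_INT ballI closed_Collect_le continuous_intros)
  finally show ?thesis .
qed

lemma elementary_loop_mod:
  assumes "elementary_loop P f m J"
  shows "J (i mod m) = J i"
proof -
  have "J (r + k * m) = J r" for r k
  proof (induction k)
    case (Suc k)
    have "J (r + k * m + m) = J (r + k * m)" using assms by (simp add: elementary_loop_def)
    then show ?case using Suc by (simp add: algebra_simps)
  qed simp
  from this[of "i mod m" "i div m"] show ?thesis by simp
qed

text \<open>Poincare-Miranda on the product of \<open>m\<close> blocks, applied to the defects. A
  face in direction \<open>e\<close> lies on the cube of an endpoint \<open>k\<close>, so its image
  is within one unit of \<open>f k\<close> and weakly beyond a face of the next block; in the other
  directions images stay within the width of the blocks.\<close>

lemma loop_pseudo_orbit:
  fixes g :: "real ^ 'N::finite \<Rightarrow> real ^ 'N"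
  assumes "compact S" "continuous_on S g"
    and gap: "\<And>x y. x \<in> P \<Longrightarrow> y \<in> P \<Longrightarrow> x \<noteq> y \<Longrightarrow> 2 \<le> \<bar>x - y\<bar>"
    and block_S: "\<And>x y. x \<in> P \<Longrightarrow> y \<in> P \<Longrightarrow> block e (x, y) \<subseteq> S"
    and g: "\<And>x j. x \<in> S \<Longrightarrow> j \<noteq> e \<Longrightarrow> \<bar>g x $ j\<bar> \<le> 1"
    and cube: "\<And>k x. k \<in> P \<Longrightarrow> x \<in> S \<Longrightarrow> \<bar>x $ e - k\<bar> \<le> 1 \<Longrightarrow> \<bar>g x $ e - f k\<bar> \<le> 1"
    and loop: "elementary_loop P f m J" "0 < m" and "0 < \<epsilon>"
  shows "\<exists>X. (\<forall>i. X (i + m) = X i) \<and> (\<forall>i. X i \<in> block e (J i)) \<and>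
    (\<forall>i l. \<bar>g (X i) $ l - X (Suc i) $ l\<bar> \<le> \<epsilon>)"
proof -
  define lo where "lo i = min (fst (J i)) (snd (J i))" for i
  define hi where "hi i = max (fst (J i)) (snd (J i))" for i
  have J: "fst (J i) \<in> P" "snd (J i) \<in> P" "fst (J i) \<noteq> snd (J i)" for i
    using loop by (auto simp: elementary_loop_def)
  have lohi: "lo i \<in> P" "hi i \<in> P" "lo i + 2 \<le> hi i" for i
    using J[of i] gap[OF J[of i]] by (auto simp: lo_def hi_def min_def max_def)
  have cov: "f (lo i) \<le> lo (Suc i) \<and> hi (Suc i) \<le> f (hi i) \<or>
      f (hi i) \<le> lo (Suc i) \<and> hi (Suc i) \<le> f (lo i)" for i
  proof -
    have "covers f (J i) (J (Suc i))" using loop by (auto simp: elementary_loop_def)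
    then show ?thesis
      by (auto simp: covers_def lo_def hi_def min_def max_def split: if_splits)
  qed
  \<comment> \<open>The sign records whether the two ends are mapped in order or reversed, so that
    the lower face always has nonpositive defect.\<close>
  define s :: "nat \<Rightarrow> real" where "s i = (if f (lo i) \<le> lo (Suc i) \<and> hi (Suc i) \<le> f (hi i) then 1 else - 1)" for i
  have block_iff: "x \<in> block e (J i) \<longleftrightarrow> lo i + 1 \<le> x $ e \<and> x $ e \<le> hi i - 1 \<and> (\<forall>j. j \<noteq> e \<longrightarrow> \<bar>x $ j\<bar> \<le> 1)"
    for x i by (auto simp: block_def lo_def hi_def abs_le_iff)
  have block_S': "block e (J i) \<subseteq> S" for i
    using block_S[OF J(1,2)[of i]] by simp
  have lohi_mod: "lo (i mod m) = lo i" "hi (i mod m) = hi i" for i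
    using elementary_loop_mod[OF loop(1)] by (simp_all add: lo_def hi_def)
  define V :: "(nat \<times> 'N \<Rightarrow> real) \<Rightarrow> nat \<Rightarrow> real ^ 'N" where "V x i = (\<chi> l. x (i mod m, l))" for x i
  define a :: "nat \<times> 'N \<Rightarrow> real" where "a = (\<lambda>(i, l). if l = e then lo i + 1 else - 1)"
  define b :: "nat \<times> 'N \<Rightarrow> real" where "b = (\<lambda>(i, l). if l = e then hi i - 1 else 1)"
  text \<open>In direction \<open>e\<close> the sign of \<open>g (X i) - X (i + 1)\<close> is governed by the faces of the block of \<open>X i\<close>,
    in the other directions by the faces of the block of \<open>X (i + 1)\<close>; the latter defect is therefore
    filed under index \<open>i + 1\<close>.\<close>
  define F :: "(nat \<times> 'N \<Rightarrow> real) \<Rightarrow> nat \<times> 'N \<Rightarrow> real" where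
    "F x = (\<lambda>(i, l). if l = e then s i * (g (V x i) $ e - V x (Suc i) $ e)
       else x (i, l) - g (V x (i + m - 1)) $ l)" for x
  have V: "V x i \<in> block e (J i)" if bounds: "\<forall>i. a i \<le> x i \<and> x i \<le> b i" for x i
  proof -
    have "lo i + 1 \<le> x (i mod m, e) \<and> x (i mod m, e) \<le> hi i - 1"
      using that[rule_format, of "(i mod m, e)"] by (simp add: a_def b_def lohi_mod)
    moreover have "\<bar>x (i mod m, l)\<bar> \<le> 1" if "l \<noteq> e" for l
      using bounds[rule_format, of "(i mod m, l)"] that by (simp add: a_def b_def abs_le_iff)
    ultimately show ?thesis by (simp add: block_iff V_def)
  qed
  have VS: "V x i \<in> S" if "\<forall>i. a i \<le> x i \<and> x i \<le> b i" for x i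
    using V[OF that] block_S' by blast
  have Vmod: "V x (i mod m) = V x i" for x i by (simp add: V_def)
  have "uniformly_continuous_on S g"
    using assms by (simp add: compact_uniformly_continuous)
  then obtain \<delta>' where \<delta>': "0 < \<delta>'"
    "\<And>x y. x \<in> S \<Longrightarrow> y \<in> S \<Longrightarrow> dist x y < \<delta>' \<Longrightarrow> dist (g x) (g y) < \<epsilon> / 2"
    using \<open>0 < \<epsilon>\<close> unfolding uniformly_continuous_on_def by (metis half_gt_zero)
  \<comment> \<open>Each of the two terms of a defect may change by half of
    \<open>\<epsilon>\<close>; the factor \<open>CARD('N)\<close> comes from bounding the norm by
    the sum of the components.\<close>
  define \<delta> where "\<delta> = min (\<epsilon> / 2) (\<delta>' / (2 * CARD('N)))"
  have "0 < \<delta>" using \<delta>' \<open>0 < \<epsilon>\<close> by (simp add: \<delta>_def)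
  obtain x where box: "\<forall>i. a i \<le> x i \<and> x i \<le> b i" and x: "\<And>i. i \<in> {..<m} \<times> UNIV \<Longrightarrow> \<bar>F x i\<bar> \<le> \<epsilon>"
  proof (rule poincare_miranda_approx[where A = "{..<m} \<times> UNIV" and a = a and b = b and F = F])
    show "a i \<le> b i" for i using lohi(3)[of "fst i"] by (auto simp: a_def b_def split: prod.split)
    show "0 < \<delta>" by fact
  next
    fix x y :: "nat \<times> 'N \<Rightarrow> real" and i :: "nat \<times> 'N"
    assume x: "\<forall>i. a i \<le> x i \<and> x i \<le> b i" and y: "\<forall>i. a i \<le> y i \<and> y i \<le> b i"
      and near: "\<And>j. j \<in> {..<m} \<times> UNIV \<Longrightarrow> \<bar>x j - y j\<bar> \<le> \<delta>" and i: "i \<in> {..<m} \<times> UNIV"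
    have comp: "\<bar>V x k $ l - V y k $ l\<bar> \<le> \<delta>" for k l
      using near[of "(k mod m, l)"] loop by (simp add: V_def)
    have gcomp: "\<bar>g (V x k) $ l - g (V y k) $ l\<bar> \<le> \<epsilon> / 2" for k l
    proof -
      have "norm (V x k - V y k) \<le> (\<Sum>l\<in>UNIV. \<bar>(V x k - V y k) $ l\<bar>)" by (rule norm_le_l1_cart)
      also have "\<dots> \<le> of_nat CARD('N) * \<delta>"
        using comp by (intro sum_bounded_above) auto
      also have "\<dots> \<le> of_nat CARD('N) * (\<delta>' / (2 * CARD('N)))"
        by (intro mult_left_mono) (auto simp: \<delta>_def)
      also have "\<dots> < \<delta>'" using \<delta>' by simp
      finally have "dist (V x k) (V y k) < \<delta>'" by (simp add: dist_norm)
      then have "norm (g (V x k) - g (V y k)) < \<epsilon> / 2"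
        using \<delta>'(2) VS x y by (metis dist_norm)
      then show ?thesis
        using component_le_norm_cart[of "g (V x k) - g (V y k)" l] by simp
    qed
    have \<delta>\<epsilon>: "\<delta> \<le> \<epsilon> / 2" by (simp add: \<delta>_def)
    obtain k l where kl: "i = (k, l)" by fastforce
    show "\<bar>F x i - F y i\<bar> \<le> \<epsilon>"
    proof (cases "l = e")
      case True
      have "\<bar>F x i - F y i\<bar> = \<bar>(g (V x k) $ e - g (V y k) $ e) - (V x (Suc k) $ e - V y (Suc k) $ e)\<bar>"
        using True kl by (simp add: F_def s_def) argo
      also have "\<dots> \<le> \<epsilon>" using gcomp[of k e] comp[of "Suc k" e] \<delta>\<epsilon> by linarith
      finally show ?thesis .
    next
      case False
      have "\<bar>F x i - F y i\<bar> = \<bar>(x i - y i) - (g (V x (k + m - 1)) $ l - g (V y (k + m - 1)) $ l)\<bar>"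
        using False kl by (simp add: F_def)
      also have "\<dots> \<le> \<epsilon>" using gcomp[of "k + m - 1" l] near[OF i] \<delta>\<epsilon> by linarith
      finally show ?thesis .
    qed
  next
    fix x :: "nat \<times> 'N \<Rightarrow> real" and i :: "nat \<times> 'N"
    assume x: "\<forall>i. a i \<le> x i \<and> x i \<le> b i" and i: "i \<in> {..<m} \<times> UNIV"
    obtain k l where kl: "i = (k, l)" "k < m" using i by auto
    note next_block = V[OF x, of "Suc k", unfolded block_iff]
    note gV = g[OF VS[OF x], of l "k + m - 1"]
    show "F x i \<le> 0" if "x i = a i"
    proof (cases "l = e")
      case True
      then have "V x k $ e = lo k + 1" using that kl by (simp add: V_def a_def)
      then have "\<bar>g (V x k) $ e - f (lo k)\<bar> \<le> 1" using VS[OF x] lohi by (intro cube) auto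
      then show ?thesis using True kl next_block cov[of k] by (auto simp: F_def s_def)
    next
      case False
      then show ?thesis using that kl gV by (simp add: F_def a_def)
    qed
    show "0 \<le> F x i" if "x i = b i"
    proof (cases "l = e")
      case True
      then have "V x k $ e = hi k - 1" using that kl by (simp add: V_def b_def)
      then have "\<bar>g (V x k) $ e - f (hi k)\<bar> \<le> 1" using VS[OF x] lohi by (intro cube) auto
      then show ?thesis using True kl next_block cov[of k] by (auto simp: F_def s_def)
    next
      case False
      then show ?thesis using that kl gV by (simp add: F_def b_def)
    qed
  qed auto
  have "\<bar>g (V x i) $ l - V x (Suc i) $ l\<bar> \<le> \<epsilon>" for i l
  proof (cases "l = e")
    case True
    have "\<bar>F x (i mod m, e)\<bar> \<le> \<epsilon>" using loop by (intro x) auto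
    moreover have "V x (Suc (i mod m)) = V x (Suc i)" by (metis Vmod mod_Suc_eq)
    ultimately show ?thesis using True by (auto simp: F_def s_def Vmod split: if_splits)
  next
    case False
    have "\<bar>F x (Suc i mod m, l)\<bar> \<le> \<epsilon>" using loop by (intro x) auto
    \<comment> \<open>Adding \<open>m\<close> before subtracting one gives the predecessor modulo
      \<open>m\<close> without truncation at zero.\<close>
    moreover have "V x (Suc i mod m + m - 1) = V x i"
    proof -
      have "(Suc i mod m + m - 1) mod m = (Suc i mod m + (m - 1)) mod m" using loop by simp
      also have "\<dots> = (Suc i + (m - 1)) mod m" by (rule mod_add_left_eq)
      also have "\<dots> = i mod m" using loop by simp
      finally show ?thesis by (metis Vmod)
    qed
    ultimately show ?thesis using False by (simp add: F_def V_def abs_minus_commute)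
  qed
  then show ?thesis
    using V[OF box] by (intro exI[of _ "V x"]) (auto simp: V_def)
qed

text \<open>By compactness the starting points of ever better pseudo-orbits converge along a
  subsequence. By continuity the later points converge to the orbit of the limit, which inherits the
  period and, the blocks being closed, the itinerary.\<close>

lemma loop_periodic_point:
  fixes g :: "real ^ 'N::finite \<Rightarrow> real ^ 'N"
  assumes "compact S" "continuous_on S g"
    and "\<And>x y. x \<in> P \<Longrightarrow> y \<in> P \<Longrightarrow> x \<noteq> y \<Longrightarrow> 2 \<le> \<bar>x - y\<bar>"
    and block_S: "\<And>x y. x \<in> P \<Longrightarrow> y \<in> P \<Longrightarrow> block e (x, y) \<subseteq> S"
    and "\<And>x j. x \<in> S \<Longrightarrow> j \<noteq> e \<Longrightarrow> \<bar>g x $ j\<bar> \<le> 1"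
    and "\<And>k x. k \<in> P \<Longrightarrow> x \<in> S \<Longrightarrow> \<bar>x $ e - k\<bar> \<le> 1 \<Longrightarrow> \<bar>g x $ e - f k\<bar> \<le> 1"
    and loop: "elementary_loop P f m J" "0 < m"
  shows "\<exists>y. (g ^^ m) y = y \<and> (\<forall>i. (g ^^ i) y \<in> block e (J i))"
proof -
  have block_S': "block e (J i) \<subseteq> S" for i
  proof -
    have "fst (J i) \<in> P" "snd (J i) \<in> P" using loop by (auto simp: elementary_loop_def)
    from block_S[OF this] show ?thesis by simp
  qed
  have "\<exists>X. (\<forall>i. X (i + m) = X i) \<and> (\<forall>i. X i \<in> block e (J i)) \<and>
      (\<forall>i l. \<bar>g (X i) $ l - X (Suc i) $ l\<bar> \<le> inverse (real (Suc n)))" for n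
    by (rule loop_pseudo_orbit[OF assms]) simp_all
  then obtain X where per: "\<And>n i. X n (i + m) = X n i" and X: "\<And>n i. X n i \<in> block e (J i)"
    and err: "\<And>n i l. \<bar>g (X n i) $ l - X n (Suc i) $ l\<bar> \<le> inverse (real (Suc n))"
    by metis
  have "\<forall>n. X n 0 \<in> S" using X block_S' by blast
  then obtain y r where r: "strict_mono (r :: nat \<Rightarrow> nat)" and y: "((\<lambda>n. X n 0) \<circ> r) \<longlonglongrightarrow> y"
    using \<open>compact S\<close> unfolding compact_def by metis
  have lim_block: "z \<in> block e (J i)" if "(\<lambda>n. X (r n) i) \<longlonglongrightarrow> z" for z i
    using closed_sequentially[OF closed_block _ that] X by blast
  have lim: "(\<lambda>n. X (r n) i) \<longlonglongrightarrow> (g ^^ i) y" for i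
  proof (induction i)
    case 0
    then show ?case using y by (simp add: o_def)
  next
    case (Suc i)
    have "(\<lambda>n. g (X (r n) i)) \<longlonglongrightarrow> g ((g ^^ i) y)"
      using lim_block[OF Suc] X block_S'
      by (intro continuous_on_tendsto_compose[OF \<open>continuous_on S g\<close> Suc]) (auto intro!: always_eventually)
    show ?case
    proof (rule vec_tendstoI)
      fix l
      have "(\<lambda>n. inverse (real (Suc (r n)))) \<longlonglongrightarrow> 0"
        using LIMSEQ_subseq_LIMSEQ[OF LIMSEQ_inverse_real_of_nat r] by (simp add: o_def)
      then have "(\<lambda>n. g (X (r n) i) $ l - X (r n) (Suc i) $ l) \<longlonglongrightarrow> 0"
        by (rule Lim_null_comparison[rotated]) (use err in \<open>auto intro!: always_eventually\<close>)
      with tendsto_vec_nth[OF \<open>(\<lambda>n. g (X (r n) i)) \<longlonglongrightarrow> _\<close>, of l]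
      have "(\<lambda>n. g (X (r n) i) $ l - (g (X (r n) i) $ l - X (r n) (Suc i) $ l)) \<longlonglongrightarrow> g ((g ^^ i) y) $ l - 0"
        by (rule tendsto_diff)
      then show "(\<lambda>n. X (r n) (Suc i) $ l) \<longlonglongrightarrow> (g ^^ Suc i) y $ l" by simp
    qed
  qed
  have "(g ^^ m) y = y"
    using LIMSEQ_unique[OF lim[of m]] lim[of 0] per[of _ 0] by simp
  then show ?thesis using lim_block lim by blast
qed

lemma separated_imp_disjoint_blocks:
  assumes "separated I J"
  shows "block e I \<inter> block e J = {}"
  using assms by (auto simp: separated_def block_def)

section \<open>Passage from the contracting grid to loops and back\<close>

theorem theorem20:
  fixes e :: "'N::finite"
    and U V G :: "(real ^ 'N) set"
    and F h :: "real ^ 'N \<Rightarrow> real ^ 'N"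
    and n m :: nat
    and p\<^sub>0 :: "real ^ 'N"
  assumes "open U"
    and "continuous_on U F"
    and "1 < n"
    and "periodic_point U F n p\<^sub>0"
    and "contracting_grid e n U F (orbit_points F n p\<^sub>0) G V h"
    and "n \<lhd>\<^sub>S m"
  shows "\<exists>q. periodic_point U F m q"
proof -
  let ?S = "model_grid e n" and ?O = "orbit_points F n p\<^sub>0"
  define g where "g = conjugate V h F"
  obtain k where k: "homeomorphism V U h k" and SV: "?S \<subseteq> V"
    and O: "?O = h ` model_orbit e n" and G: "G = h ` ?S"
    and FG: "F ` G \<subseteq> interior G"
    and cubes: "\<And>c. c \<in> model_orbit e n \<Longrightarrow>
      F ` h ` inner_cube e n c \<subseteq> interior (h ` inner_cube e n (g c))"
    using assms(5) by (auto simp: contracting_grid_def grid_enclosing_def g_def)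
  have inj: "inj_on h V" and hV: "h ` V = U" and kh: "\<And>x. x \<in> V \<Longrightarrow> k (h x) = x"
    using k by (auto simp: homeomorphism_def intro: inj_on_inverseI)
  \<comment> \<open>\<open>F\<close> maps the grid into itself, so \<open>inv_into V h\<close>
    returns a point of the model grid and \<open>h\<close> carries \<open>g\<close> to
    \<open>F\<close>.\<close>
  have gS: "g x \<in> ?S" and hg: "h (g x) = F (h x)" if "x \<in> ?S" for x
  proof -
    have "F (h x) \<in> h ` ?S" using FG interior_subset that unfolding G by blast
    then obtain z where z: "z \<in> ?S" "F (h x) = h z" by blast
    then have "g x = z"
      using SV inj by (auto simp: g_def conjugate_def intro!: inv_into_f_f)
    then show "g x \<in> ?S" "h (g x) = F (h x)" using z by simp_all
  qed
  have g_eq: "g x = k (F (h x))" if "x \<in> ?S" for x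
    using kh[of "g x"] gS[OF that] hg[OF that] SV by auto
  have hU: "h ` ?S \<subseteq> U" using SV hV by blast
  have "continuous_on ?S h" "continuous_on U k"
    using k SV by (auto simp: homeomorphism_def intro: continuous_on_subset)
  then have "continuous_on ?S (F \<circ> h)"
    using assms(2) hU by (intro continuous_on_compose) (auto intro: continuous_on_subset)
  moreover have "(F \<circ> h) ` ?S \<subseteq> U"
    using FG interior_subset[of G] hU unfolding G by (simp add: image_comp[symmetric]) blast
  ultimately have "continuous_on ?S (k \<circ> (F \<circ> h))"
    using \<open>continuous_on U k\<close> continuous_on_subset by (blast intro: continuous_on_compose)
  then have cont: "continuous_on ?S g"
    by (rule continuous_on_eq) (simp add: g_eq)
  have S_box: "?S = cbox (\<chi> j. if j = e then 0 else - 1) (\<chi> j. if j = e then 4 * real n - 2 else 1)"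
    unfolding model_grid_def by (auto simp: mem_box_cart) metis+
  \<comment> \<open>\<open>P\<close> holds the coordinates of the orbit points along
    \<open>e\<close>, and \<open>f\<close> is the permutation that \<open>g\<close> induces on
    them.\<close>
  define P where "P = (\<lambda>i. 4 * real i + 1) ` {..<n}"
  define f where "f t = g (axis e t) $ e" for t
  have orbit: "model_orbit e n = axis e ` P"
    by (simp add: model_orbit_def P_def image_image)
  have PS: "axis e t \<in> ?S" if "t \<in> P" for t
    using that by (auto simp: P_def model_grid_def axis_def)
  have g_axis: "g (axis e t) = axis e (f t)" "f t \<in> P" if tP: "t \<in> P" for t
  proof -
    have F_orbit: "F x \<in> ?O" if x: "x \<in> ?O" for x
    proof -
      obtain i where i: "i < n" "x = (F ^^ i) p\<^sub>0" using x by (auto simp: orbit_points_def)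
      then have "F x = (F ^^ (Suc i)) p\<^sub>0" by simp
      moreover have "(F ^^ n) p\<^sub>0 = (F ^^ 0) p\<^sub>0" using assms(4) by (simp add: periodic_point_def)
      ultimately have "F x = (F ^^ (Suc i mod n)) p\<^sub>0"
        using i(1) by (cases "Suc i = n") (simp_all del: funpow.simps(2))
      then show ?thesis unfolding orbit_points_def using assms(3) by (auto intro: image_eqI[of _ _ "Suc i mod n"])
    qed
    have "F (h (axis e t)) \<in> h ` axis e ` P"
      using F_orbit tP O orbit by blast
    then obtain t' where t': "t' \<in> P" "h (g (axis e t)) = h (axis e t')"
      using hg[OF PS[OF tP]] by auto
    then have "g (axis e t) = axis e t'"
      using inj SV gS[OF PS[OF tP]] PS[OF t'(1)] by (auto dest: inj_onD)
    then show "g (axis e t) = axis e (f t)" "f t \<in> P"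
      using t' by (simp_all add: f_def axis_def)
  qed
  have "transitive_on P f"
    unfolding transitive_on_def
  proof (intro conjI allI impI)
    show "finite P" by (simp add: P_def)
    show "f ` P \<subseteq> P" using g_axis by blast
    fix Q assume Q: "Q \<subseteq> P \<and> Q \<noteq> {} \<and> f ` Q \<subseteq> Q"
    \<comment> \<open>\<open>?T\<close> is the part of the orbit over \<open>Q\<close>. It is
      invariant under \<open>F\<close>, and an invariant set containing one point of a periodic
      orbit contains all of it.\<close>
    let ?T = "(\<lambda>t. h (axis e t)) ` Q"
    have T: "F x \<in> ?T" if x: "x \<in> ?T" for x
    proof -
      obtain t where t: "t \<in> Q" "x = h (axis e t)" using x by blast
      then have "F x = h (axis e (f t))" using hg[OF PS] g_axis Q by auto
      then show ?thesis using t Q by blast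
    qed
    obtain t where "t \<in> Q" using Q by blast
    then have "h (axis e t) \<in> ?O" using Q O orbit by blast
    then obtain i where i: "i < n" "h (axis e t) = (F ^^ i) p\<^sub>0" by (auto simp: orbit_points_def)
    have iter: "(F ^^ j) (h (axis e t)) \<in> ?T" for j
      using \<open>t \<in> Q\<close> T by (induction j) auto
    have "x \<in> ?T" if x: "x \<in> ?O" for x
    proof -
      obtain j where j: "x = (F ^^ j) p\<^sub>0" using x by (auto simp: orbit_points_def)
      also have "\<dots> = (F ^^ j) ((F ^^ n) p\<^sub>0)"
        using assms(4) by (simp add: periodic_point_def)
      also have "\<dots> = (F ^^ (j + n)) p\<^sub>0" by (simp add: funpow_add)
      \<comment> \<open>The extra turn of \<open>n\<close> steps makes the orbit pass its
        \<open>i\<close>-th point before reaching \<open>x\<close>, even if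
        \<open>j < i\<close>.\<close>
      also have "j + n = j + (n - i) + i" using i by simp
      also have "(F ^^ \<dots>) p\<^sub>0 = (F ^^ (j + (n - i))) (h (axis e t))"
        unfolding i(2) by (simp only: funpow_add o_apply)
      finally show ?thesis using iter by simp
    qed
    then have "h ` axis e ` P \<subseteq> h ` axis e ` Q" using O orbit by (auto simp: image_image)
    moreover have "axis e ` P \<subseteq> V" "axis e ` Q \<subseteq> V" using PS SV Q by auto
    ultimately have "axis e ` P \<subseteq> axis e ` Q"
      using inj by (simp add: inj_on_image_subset_iff)
    moreover have "inj (axis e :: real \<Rightarrow> real ^ 'N)"
      by (rule injI) (auto simp: axis_eq_axis)
    ultimately show "Q = P" using Q by (simp add: inj_image_subset_iff)
  qed
  moreover have "card P = n"
    unfolding P_def by (subst card_image) (auto intro: inj_onI)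
  ultimately obtain J where J: "elementary_loop P f m J"
    using sharkovskii_loop assms(3,6) by blast
  have "0 < m" using sharkovskii_one_or_even_or_greater[OF assms(6)] by auto
  have "\<exists>y. (g ^^ m) y = y \<and> (\<forall>i. (g ^^ i) y \<in> block e (J i))"
  proof (rule loop_periodic_point[OF _ cont _ _ _ _ J \<open>0 < m\<close>])
    show "compact ?S" unfolding S_box by (rule compact_cbox)
    show "2 \<le> \<bar>x - y\<bar>" if xy: "x \<in> P" "y \<in> P" "x \<noteq> y" for x y
    proof -
      obtain i j where ij: "x = 4 * real i + 1" "y = 4 * real j + 1" using xy by (auto simp: P_def)
      with xy have "i < j \<or> j < i" by auto
      then show ?thesis using ij by auto
    qed
    show "block e (x, y) \<subseteq> ?S" if "x \<in> P" "y \<in> P" for x y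
    proof -
      have "1 \<le> t \<and> t \<le> 4 * real n - 3" if "t \<in> P" for t
        using that by (auto simp: P_def)
      from this[OF \<open>x \<in> P\<close>] this[OF \<open>y \<in> P\<close>] show ?thesis
        by (auto simp: block_def model_grid_def)
    qed
    show "\<bar>g x $ j\<bar> \<le> 1" if "x \<in> ?S" "j \<noteq> e" for x j
      using gS[OF that(1)] that(2) by (auto simp: model_grid_def abs_le_iff minus_le_iff)
    fix t x assume t: "t \<in> P" and x: "x \<in> ?S" "\<bar>x $ e - t\<bar> \<le> 1"
    then have "x \<in> inner_cube e n (axis e t)" by (auto simp: inner_cube_def)
    moreover have "axis e t \<in> model_orbit e n" using t orbit by blast
    ultimately have "F (h x) \<in> h ` inner_cube e n (g (axis e t))"
      using cubes interior_subset by blast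
    then obtain z where z: "z \<in> inner_cube e n (g (axis e t))" "h (g x) = h z"
      using hg[OF x(1)] by auto
    then have "g x = z"
      using inj SV gS[OF x(1)] by (auto simp: inner_cube_def dest: inj_onD)
    then show "\<bar>g x $ e - f t\<bar> \<le> 1" using z by (auto simp: inner_cube_def f_def)
  qed
  then obtain y where y: "(g ^^ m) y = y" "\<And>i. (g ^^ i) y \<in> block e (J i)" by blast
  have yS: "(g ^^ i) y \<in> ?S" for i
  proof -
    have "fst (J i) \<in> P" "snd (J i) \<in> P" using J by (auto simp: elementary_loop_def)
    then show ?thesis using y(2)[of i] by (auto simp: P_def block_def model_grid_def)
  qed
  have conj: "(F ^^ i) (h y) = h ((g ^^ i) y)" for i
    by (induction i) (use hg[OF yS] in simp_all)
  have "periodic_point U F m (h y)"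
    unfolding periodic_point_def
  proof (intro conjI allI impI)
    show "0 < m" by fact
    show "(F ^^ i) (h y) \<in> U" for i using conj yS hU by auto
    show "(F ^^ m) (h y) = h y" using conj y by simp
    fix d assume d: "0 < d \<and> d < m"
    show "(F ^^ d) (h y) \<noteq> h y"
    proof
      assume "(F ^^ d) (h y) = h y"
      then have "(g ^^ d) y = y"
        using conj[of d] yS[of d] yS[of 0] inj SV by (auto dest: inj_onD)
      then have "(g ^^ (i + d)) y = (g ^^ i) y" for i by (simp add: funpow_add)
      moreover obtain i where "separated (J i) (J (i + d))"
        using J d by (auto simp: elementary_loop_def)
      ultimately show False
        using separated_imp_disjoint_blocks[of "J i" "J (i + d)" e] y(2)[of i] y(2)[of "i + d"]
        by auto
    qed
  qed
  then show ?thesis by blast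
qed

end
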